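(* Let $\mathcal{Q}$ be a small quantaloid and let $\phi:\mathbb{A}\nrightarrow\mathbb{B}$ be a $\mathcal{Q}$-distributor between $\mathcal{Q}$-categories. Let $\phi_{\uparrow}:\mathcal{P}\mathbb{A}\to\mathcal{P}^{\dagger}\mathbb{B}$ and $\phi^{\downarrow}:\mathcal{P}^{\dagger}\mathbb{B}\to\mathcal{P}\mathbb{A}$ be the $\mathcal{Q}$-functors $\phi_{\uparrow}(\mu)=\phi\swarrow\mu$ and $\phi^{\downarrow}(\lambda)=\lambda\searrow\phi$. Then $\phi_{\uparrow}$ is left adjoint to $\phi^{\downarrow}$ in the category of $\mathcal{Q}$-categories and $\mathcal{Q}$-functors, i.e. $\phi_{\uparrow}\dashv\phi^{\downarrow}$.
   Context: A small quantaloid $\mathcal{Q}$ is a category with a set $\mathcal{Q}_0$ of objects, each hom-set $\mathcal{Q}(A,B)$ a complete lattice, and composition $\circ$ preserving arbitrary joins in each variable. For $f\in\mathcal{Q}(A,B)$ and $g\in\mathcal{Q}(A,X)$, $g\swarrow f\in\mathcal{Q}(B,X)$ is the largest $h$ with $h\circ f\le g$; for $f\in\mathcal{Q}(A,B)$ and $g\in\mathcal{Q}(X,B)$, $f\searrow g\in\mathcal{Q}(X,A)$ is the largest $h$ with $f\circ h\le g$. A $\mathcal{Q}$-category $\mathbb{A}$ is a set $\mathbb{A}_0$ with a type map $t:\mathbb{A}_0\to\mathcal{Q}_0$ and hom-arrows $\mathbb{A}(x,y)\in\mathcal{Q}(tx,ty)$ such that $1_{tx}\le\mathbb{A}(x,x)$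 and $\mathbb{A}(y,z)\circ\mathbb{A}(x,y)\le\mathbb{A}(x,z)$. A $\mathcal{Q}$-functor $F:\mathbb{A}\to\mathbb{B}$ is a type-preserving map $\mathbb{A}_0\to\mathbb{B}_0$ with $\mathbb{A}(x,x')\le\mathbb{B}(Fx,Fx')$. Underlying preorder: $x\le y$ iff $tx=ty$ and $1_{tx}\le\mathbb{A}(x,y)$; $\mathcal{Q}$-functors are preordered pointwise. $F\dashv G$ (for $F:\mathbb{A}\to\mathbb{B}$, $G:\mathbb{B}\to\mathbb{A}$) means $1_{\mathbb{A}}\le G\circ F$ and $F\circ G\le 1_{\mathbb{B}}$. A $\mathcal{Q}$-distributor $\phi:\mathbb{A}\nrightarrow\mathbb{B}$ is a family $\phi(x,y)\in\mathcal{Q}(tx,ty)$ ($x\in\mathbb{A}_0,y\in\mathbb{B}_0$) with $\mathbb{B}(y',y)\circ\phi(x,y')\le\phi(x,y)$ and $\phi(x',y)\circ\mathbb{A}(x,x')\le\phi(x,y)$; distributors are ordered pointwise. For $\phi:\mathbb{A}\nrightarrow\mathbb{B}$, $\psi:\mathbb{B}\nrightarrow\mathbb{C}$, $\eta:\mathbb{A}\nrightarrow\mathbb{C}$: $(\psi\circ\phi)(x,z)=\bigvee_y\psi(y,z)\circ\phi(x,y)$; $\eta\swarrow\phi:\mathbb{B}\nrightarrow\mathbb{C}$ is $(\eta\swarrow\phi)(y,z)=\bigwedge_x\eta(x,z)\swarrow\phi(x,y)$; $\psi\searrow\eta:\mathbb{A}\nrightarrow\mathbb{B}$ is $(\psi\searrow\eta)(x,y)=\bigwedge_z\psi(y,z)\searrow\eta(x,z)$.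 For $X\in\mathcal{Q}_0$, $*_X$ is the $\mathcal{Q}$-category with one object $*$ of type $X$ and hom-arrow $1_X$. $\mathcal{P}\mathbb{A}$ is the $\mathcal{Q}$-category whose objects of type $X$ are the distributors $\mu:\mathbb{A}\nrightarrow *_X$, with $\mathcal{P}\mathbb{A}(\mu,\lambda)=\lambda\swarrow\mu$. $\mathcal{P}^{\dagger}\mathbb{A}$ is the $\mathcal{Q}$-category whose objects of type $X$ are the distributors $\mu:*_X\nrightarrow\mathbb{A}$, with $\mathcal{P}^{\dagger}\mathbb{A}(\mu,\lambda)=\lambda\searrow\mu$ (so its underlying order is the reverse of the pointwise order of distributors). *)

theory Defs
  imports "HOL-Algebra.Complete_Lattice"
begin

section \<open>Small quantaloids\<close>

text \<open>
  The hom-sets of a quantaloid need not be disjoint as sets of arrows, so composition carries its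
  three objects: \<open>Comp Q A B C g f\<close> is \<open>g \<circ> f\<close> for \<open>f \<in> Q(A,B)\<close> and \<open>g \<in> Q(B,C)\<close>.
\<close>

record ('o, 'm) quantaloid_data =
  Ob :: "'o set"
  Hom :: "'o \<Rightarrow> 'o \<Rightarrow> 'm gorder"
  Comp :: "'o \<Rightarrow> 'o \<Rightarrow> 'o \<Rightarrow> 'm \<Rightarrow> 'm \<Rightarrow> 'm"
  One :: "'o \<Rightarrow> 'm"

abbreviation arrows :: "('o, 'm) quantaloid_data \<Rightarrow> 'o \<Rightarrow> 'o \<Rightarrow> 'm set"
  where "arrows Q A B \<equiv> carrier (Hom Q A B)"

locale quantaloid =
  fixes Q :: "('o, 'm) quantaloid_data"
  assumes complete_lattice_Hom:
      "\<And>A B. \<lbrakk>A \<in> Ob Q; B \<in> Ob Q\<rbrakk> \<Longrightarrow> complete_lattice (Hom Q A B)"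
    and Comp_closed:
      "\<And>A B C f g. \<lbrakk>A \<in> Ob Q; B \<in> Ob Q; C \<in> Ob Q; f \<in> arrows Q A B; g \<in> arrows Q B C\<rbrakk>
        \<Longrightarrow> Comp Q A B C g f \<in> arrows Q A C"
    and One_closed:
      "\<And>A. A \<in> Ob Q \<Longrightarrow> One Q A \<in> arrows Q A A"
    and Comp_assoc:
      "\<And>A B C D f g h. \<lbrakk>A \<in> Ob Q; B \<in> Ob Q; C \<in> Ob Q; D \<in> Ob Q;
          f \<in> arrows Q A B; g \<in> arrows Q B C; h \<in> arrows Q C D\<rbrakk>
        \<Longrightarrow> Comp Q A B D (Comp Q B C D h g) f = Comp Q A C D h (Comp Q A B C g f)"
    and Comp_One_left:
      "\<And>A B f. \<lbrakk>A \<in> Ob Q; B \<in> Ob Q; f \<in> arrows Q A B\<rbrakk> \<Longrightarrow> Comp Q A B B (One Q B) f = f"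
    and Comp_One_right:
      "\<And>A B f. \<lbrakk>A \<in> Ob Q; B \<in> Ob Q; f \<in> arrows Q A B\<rbrakk> \<Longrightarrow> Comp Q A A B f (One Q A) = f"
    and Comp_Sup_right:
      "\<And>A B C g S. \<lbrakk>A \<in> Ob Q; B \<in> Ob Q; C \<in> Ob Q; g \<in> arrows Q B C; S \<subseteq> arrows Q A B\<rbrakk>
        \<Longrightarrow> Comp Q A B C g (\<Squnion>\<^bsub>Hom Q A B\<^esub> S) = \<Squnion>\<^bsub>Hom Q A C\<^esub> ((\<lambda>f. Comp Q A B C g f) ` S)"
    and Comp_Sup_left:
      "\<And>A B C f S. \<lbrakk>A \<in> Ob Q; B \<in> Ob Q; C \<in> Ob Q; f \<in> arrows Q A B; S \<subseteq> arrows Q B C\<rbrakk>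
        \<Longrightarrow> Comp Q A B C (\<Squnion>\<^bsub>Hom Q B C\<^esub> S) f = \<Squnion>\<^bsub>Hom Q A C\<^esub> ((\<lambda>g. Comp Q A B C g f) ` S)"

text \<open>
  \<open>lres Q A B X g f\<close> is \<open>g \<swarrow> f\<close> for \<open>f \<in> Q(A,B)\<close>, \<open>g \<in> Q(A,X)\<close>;
  \<open>rres Q A B X f g\<close> is \<open>f \<searrow> g\<close> for \<open>f \<in> Q(A,B)\<close>, \<open>g \<in> Q(X,B)\<close>.
\<close>

definition lres :: "('o, 'm) quantaloid_data \<Rightarrow> 'o \<Rightarrow> 'o \<Rightarrow> 'o \<Rightarrow> 'm \<Rightarrow> 'm \<Rightarrow> 'm"
  where "lres Q A B X g f =
    (THE h. greatest (Hom Q B X) h {h \<in> arrows Q B X. Comp Q A B X h f \<sqsubseteq>\<^bsub>Hom Q A X\<^esub> g})"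

definition rres :: "('o, 'm) quantaloid_data \<Rightarrow> 'o \<Rightarrow> 'o \<Rightarrow> 'o \<Rightarrow> 'm \<Rightarrow> 'm \<Rightarrow> 'm"
  where "rres Q A B X f g =
    (THE h. greatest (Hom Q X A) h {h \<in> arrows Q X A. Comp Q X A B f h \<sqsubseteq>\<^bsub>Hom Q X B\<^esub> g})"

context quantaloid
begin

lemma lres_greatest:
  assumes "A \<in> Ob Q" "B \<in> Ob Q" "X \<in> Ob Q" "f \<in> arrows Q A B" "g \<in> arrows Q A X"
  shows "greatest (Hom Q B X) (lres Q A B X g f)
    {h \<in> arrows Q B X. Comp Q A B X h f \<sqsubseteq>\<^bsub>Hom Q A X\<^esub> g}"
proof -
  interpret L: complete_lattice "Hom Q B X" by (rule complete_lattice_Hom) fact+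
  interpret M: complete_lattice "Hom Q A X" by (rule complete_lattice_Hom) fact+
  let ?S = "{h \<in> arrows Q B X. Comp Q A B X h f \<sqsubseteq>\<^bsub>Hom Q A X\<^esub> g}"
  have S: "?S \<subseteq> arrows Q B X" by auto
  have cl: "(\<lambda>h. Comp Q A B X h f) ` ?S \<subseteq> arrows Q A X"
    using assms by (auto intro: Comp_closed)
  have "\<Squnion>\<^bsub>Hom Q A X\<^esub> ((\<lambda>h. Comp Q A B X h f) ` ?S) \<sqsubseteq>\<^bsub>Hom Q A X\<^esub> g"
    by (rule M.sup_least[OF cl]) (use assms in auto)
  then have "greatest (Hom Q B X) (\<Squnion>\<^bsub>Hom Q B X\<^esub> ?S) ?S"
    using Comp_Sup_left[OF assms(1,2,3,4) S] L.sup_closed[OF S] L.sup_upper[OF S]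
    unfolding greatest_def by simp
  moreover have "h = k" if "greatest (Hom Q B X) h ?S" "greatest (Hom Q B X) k ?S" for h k
    using L.weak_greatest_unique[OF that] L.eq_is_equal by simp
  ultimately show ?thesis unfolding lres_def by - (rule theI, assumption, blast)
qed

lemma rres_greatest:
  assumes "A \<in> Ob Q" "B \<in> Ob Q" "X \<in> Ob Q" "f \<in> arrows Q A B" "g \<in> arrows Q X B"
  shows "greatest (Hom Q X A) (rres Q A B X f g)
    {h \<in> arrows Q X A. Comp Q X A B f h \<sqsubseteq>\<^bsub>Hom Q X B\<^esub> g}"
proof -
  interpret L: complete_lattice "Hom Q X A" by (rule complete_lattice_Hom) fact+
  interpret M: complete_lattice "Hom Q X B" by (rule complete_lattice_Hom) fact+
  let ?S = "{h \<in> arrows Q X A. Comp Q X A B f h \<sqsubseteq>\<^bsub>Hom Q X B\<^esub> g}"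
  have S: "?S \<subseteq> arrows Q X A" by auto
  have cl: "(\<lambda>h. Comp Q X A B f h) ` ?S \<subseteq> arrows Q X B"
    using assms by (auto intro: Comp_closed)
  have "\<Squnion>\<^bsub>Hom Q X B\<^esub> ((\<lambda>h. Comp Q X A B f h) ` ?S) \<sqsubseteq>\<^bsub>Hom Q X B\<^esub> g"
    by (rule M.sup_least[OF cl]) (use assms in auto)
  then have "greatest (Hom Q X A) (\<Squnion>\<^bsub>Hom Q X A\<^esub> ?S) ?S"
    using Comp_Sup_right[OF assms(3,1,2,4) S] L.sup_closed[OF S] L.sup_upper[OF S]
    unfolding greatest_def by simp
  moreover have "h = k" if "greatest (Hom Q X A) h ?S" "greatest (Hom Q X A) k ?S" for h k
    using L.weak_greatest_unique[OF that] L.eq_is_equal by simp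
  ultimately show ?thesis unfolding rres_def by - (rule theI, assumption, blast)
qed

end


section \<open>Categories and functors enriched in a quantaloid\<close>

record ('o, 'm, 'a) qcat =
  obj :: "'a set"
  ty :: "'a \<Rightarrow> 'o"
  arr :: "'a \<Rightarrow> 'a \<Rightarrow> 'm"

definition qcategory :: "('o, 'm) quantaloid_data \<Rightarrow> ('o, 'm, 'a) qcat \<Rightarrow> bool"
  where "qcategory Q A \<longleftrightarrow>
    (\<forall>x\<in>obj A. ty A x \<in> Ob Q) \<and>
    (\<forall>x\<in>obj A. \<forall>y\<in>obj A. arr A x y \<in> arrows Q (ty A x) (ty A y)) \<and>
    (\<forall>x\<in>obj A. One Q (ty A x) \<sqsubseteq>\<^bsub>Hom Q (ty A x) (ty A x)\<^esub> arr A x x) \<and>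
    (\<forall>x\<in>obj A. \<forall>y\<in>obj A. \<forall>z\<in>obj A.
      Comp Q (ty A x) (ty A y) (ty A z) (arr A y z) (arr A x y)
        \<sqsubseteq>\<^bsub>Hom Q (ty A x) (ty A z)\<^esub> arr A x z)"

text \<open>
  Maps between object sets are taken extensional (\<open>\<rightarrow>\<^sub>E\<close>), so that equality of functors and of
  distributors in HOL is equality of the set-theoretic maps and families.
\<close>

definition qfunctor ::
    "('o, 'm) quantaloid_data \<Rightarrow> ('o, 'm, 'a) qcat \<Rightarrow> ('o, 'm, 'b) qcat \<Rightarrow> ('a \<Rightarrow> 'b) \<Rightarrow> bool"
  where "qfunctor Q A B F \<longleftrightarrow>
    qcategory Q A \<and> qcategory Q B \<and>
    F \<in> obj A \<rightarrow>\<^sub>E obj B \<and>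
    (\<forall>x\<in>obj A. ty B (F x) = ty A x) \<and>
    (\<forall>x\<in>obj A. \<forall>x'\<in>obj A.
      arr A x x' \<sqsubseteq>\<^bsub>Hom Q (ty A x) (ty A x')\<^esub> arr B (F x) (F x'))"

definition qcat_le :: "('o, 'm) quantaloid_data \<Rightarrow> ('o, 'm, 'a) qcat \<Rightarrow> 'a \<Rightarrow> 'a \<Rightarrow> bool"
  where "qcat_le Q A x y \<longleftrightarrow>
    ty A x = ty A y \<and> One Q (ty A x) \<sqsubseteq>\<^bsub>Hom Q (ty A x) (ty A x)\<^esub> arr A x y"

definition qfunctor_le ::
    "('o, 'm) quantaloid_data \<Rightarrow> ('o, 'm, 'a) qcat \<Rightarrow> ('o, 'm, 'b) qcat
      \<Rightarrow> ('a \<Rightarrow> 'b) \<Rightarrow> ('a \<Rightarrow> 'b) \<Rightarrow> bool"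
  where "qfunctor_le Q A B F G \<longleftrightarrow> (\<forall>x\<in>obj A. qcat_le Q B (F x) (G x))"

definition qadjoint ::
    "('o, 'm) quantaloid_data \<Rightarrow> ('o, 'm, 'a) qcat \<Rightarrow> ('o, 'm, 'b) qcat
      \<Rightarrow> ('a \<Rightarrow> 'b) \<Rightarrow> ('b \<Rightarrow> 'a) \<Rightarrow> bool"
  where "qadjoint Q A B F G \<longleftrightarrow>
    qfunctor Q A B F \<and> qfunctor Q B A G \<and>
    qfunctor_le Q A A (\<lambda>x\<in>obj A. x) (compose (obj A) G F) \<and>
    qfunctor_le Q B B (compose (obj B) F G) (\<lambda>y\<in>obj B. y)"


section \<open>Distributors\<close>

definition distributor ::
    "('o, 'm) quantaloid_data \<Rightarrow> ('o, 'm, 'a) qcat \<Rightarrow> ('o, 'm, 'b) qcat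
      \<Rightarrow> ('a \<Rightarrow> 'b \<Rightarrow> 'm) \<Rightarrow> bool"
  where "distributor Q A B \<phi> \<longleftrightarrow>
    qcategory Q A \<and> qcategory Q B \<and>
    \<phi> \<in> (\<Pi>\<^sub>E x\<in>obj A. \<Pi>\<^sub>E y\<in>obj B. arrows Q (ty A x) (ty B y)) \<and>
    (\<forall>x\<in>obj A. \<forall>y'\<in>obj B. \<forall>y\<in>obj B.
      Comp Q (ty A x) (ty B y') (ty B y) (arr B y' y) (\<phi> x y')
        \<sqsubseteq>\<^bsub>Hom Q (ty A x) (ty B y)\<^esub> \<phi> x y) \<and>
    (\<forall>x\<in>obj A. \<forall>x'\<in>obj A. \<forall>y\<in>obj B.
      Comp Q (ty A x) (ty A x') (ty B y) (\<phi> x' y) (arr A x x')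
        \<sqsubseteq>\<^bsub>Hom Q (ty A x) (ty B y)\<^esub> \<phi> x y)"

text \<open>
  For \<open>\<phi> : A \<rightarrow> B\<close>, \<open>\<psi> : B \<rightarrow> C\<close> and \<open>\<eta> : A \<rightarrow> C\<close>, \<open>dist_lres Q A B C \<eta> \<phi>\<close> is \<open>\<eta> \<swarrow> \<phi> : B \<rightarrow> C\<close> and
  \<open>dist_rres Q A B C \<psi> \<eta>\<close> is \<open>\<psi> \<searrow> \<eta> : A \<rightarrow> B\<close>. The meets are those of the respective hom-lattice,
  hence its top element if the index set is empty.
\<close>

definition dist_lres ::
    "('o, 'm) quantaloid_data \<Rightarrow> ('o, 'm, 'a) qcat \<Rightarrow> ('o, 'm, 'b) qcat \<Rightarrow> ('o, 'm, 'c) qcat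
      \<Rightarrow> ('a \<Rightarrow> 'c \<Rightarrow> 'm) \<Rightarrow> ('a \<Rightarrow> 'b \<Rightarrow> 'm) \<Rightarrow> 'b \<Rightarrow> 'c \<Rightarrow> 'm"
  where "dist_lres Q A B C \<eta> \<phi> = (\<lambda>y\<in>obj B. \<lambda>z\<in>obj C.
    \<Sqinter>\<^bsub>Hom Q (ty B y) (ty C z)\<^esub>
      ((\<lambda>x. lres Q (ty A x) (ty B y) (ty C z) (\<eta> x z) (\<phi> x y)) ` obj A))"

definition dist_rres ::
    "('o, 'm) quantaloid_data \<Rightarrow> ('o, 'm, 'a) qcat \<Rightarrow> ('o, 'm, 'b) qcat \<Rightarrow> ('o, 'm, 'c) qcat
      \<Rightarrow> ('b \<Rightarrow> 'c \<Rightarrow> 'm) \<Rightarrow> ('a \<Rightarrow> 'c \<Rightarrow> 'm) \<Rightarrow> 'a \<Rightarrow> 'b \<Rightarrow> 'm"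
  where "dist_rres Q A B C \<psi> \<eta> = (\<lambda>x\<in>obj A. \<lambda>y\<in>obj B.
    \<Sqinter>\<^bsub>Hom Q (ty A x) (ty B y)\<^esub>
      ((\<lambda>z. rres Q (ty B y) (ty C z) (ty A x) (\<psi> y z) (\<eta> x z)) ` obj C))"


section \<open>Presheaves and copresheaves\<close>

definition star :: "('o, 'm) quantaloid_data \<Rightarrow> 'o \<Rightarrow> ('o, 'm, unit) qcat"
  where "star Q X = \<lparr>obj = UNIV, ty = (\<lambda>_. X), arr = (\<lambda>_ _. One Q X)\<rparr>"

text \<open>
  Objects of \<open>PA\<close> and \<open>P\<dagger>A\<close> are pairs \<open>(X, \<mu>)\<close>: the type \<open>X\<close> cannot be recovered from the family
  \<open>\<mu>\<close> alone (the hom-sets may overlap and \<open>A\<close> may be empty). The hom-arrow is the single component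
  of a distributor \<open>*\<^sub>X \<rightarrow> *\<^sub>Y\<close>.
\<close>

definition presheaves ::
    "('o, 'm) quantaloid_data \<Rightarrow> ('o, 'm, 'a) qcat \<Rightarrow> ('o, 'm, 'o \<times> ('a \<Rightarrow> unit \<Rightarrow> 'm)) qcat"
  where "presheaves Q A =
    \<lparr>obj = {(X, \<mu>). X \<in> Ob Q \<and> distributor Q A (star Q X) \<mu>},
     ty = fst,
     arr = (\<lambda>(X, \<mu>) (Y, \<nu>). dist_lres Q A (star Q X) (star Q Y) \<nu> \<mu> () ())\<rparr>"

definition copresheaves ::
    "('o, 'm) quantaloid_data \<Rightarrow> ('o, 'm, 'a) qcat \<Rightarrow> ('o, 'm, 'o \<times> (unit \<Rightarrow> 'a \<Rightarrow> 'm)) qcat"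
  where "copresheaves Q A =
    \<lparr>obj = {(X, \<mu>). X \<in> Ob Q \<and> distributor Q (star Q X) A \<mu>},
     ty = fst,
     arr = (\<lambda>(X, \<mu>) (Y, \<nu>). dist_rres Q (star Q X) (star Q Y) A \<nu> \<mu> () ())\<rparr>"

text \<open>The maps \<open>\<phi>\<^sub>\<up>(\<mu>) = \<phi> \<swarrow> \<mu>\<close> and \<open>\<phi>\<^sup>\<down>(\<lambda>) = \<lambda> \<searrow> \<phi>\<close>.\<close>

definition isbell_up ::
    "('o, 'm) quantaloid_data \<Rightarrow> ('o, 'm, 'a) qcat \<Rightarrow> ('o, 'm, 'b) qcat \<Rightarrow> ('a \<Rightarrow> 'b \<Rightarrow> 'm)
      \<Rightarrow> 'o \<times> ('a \<Rightarrow> unit \<Rightarrow> 'm) \<Rightarrow> 'o \<times> (unit \<Rightarrow> 'b \<Rightarrow> 'm)"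
  where "isbell_up Q A B \<phi> =
    (\<lambda>(X, \<mu>)\<in>obj (presheaves Q A). (X, dist_lres Q A (star Q X) B \<phi> \<mu>))"

definition isbell_down ::
    "('o, 'm) quantaloid_data \<Rightarrow> ('o, 'm, 'a) qcat \<Rightarrow> ('o, 'm, 'b) qcat \<Rightarrow> ('a \<Rightarrow> 'b \<Rightarrow> 'm)
      \<Rightarrow> 'o \<times> (unit \<Rightarrow> 'b \<Rightarrow> 'm) \<Rightarrow> 'o \<times> ('a \<Rightarrow> unit \<Rightarrow> 'm)"
  where "isbell_down Q A B \<phi> =
    (\<lambda>(X, \<mu>)\<in>obj (copresheaves Q B). (X, dist_rres Q A (star Q X) B \<mu> \<phi>))"

end

theory Submission
  imports Defs
begin

text \<open>
  Both residuals of a quantaloid are adjoint to composition: \<open>h \<sqsubseteq> g \<swarrow> f\<close> iff \<open>h \<circ> f \<sqsubseteq> g\<close>, and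
  \<open>h \<sqsubseteq> f \<searrow> g\<close> iff \<open>f \<circ> h \<sqsubseteq> g\<close>. Residuals of distributors are pointwise meets of residuals of
  arrows, so they satisfy the same two equivalences componentwise (\<open>le_dist_lres_iff\<close>,
  \<open>le_dist_rres_iff\<close>). An inequality whose left-hand side is a composite of distributors, a join over
  middle objects, is stated for each middle object separately.

  Everything then reduces to the evaluation inequalities \<open>(\<eta> \<swarrow> \<phi>) \<circ> \<phi> \<sqsubseteq> \<eta>\<close>, \<open>\<psi> \<circ> (\<psi> \<searrow> \<eta>) \<sqsubseteq> \<eta>\<close>
  and their consequences \<open>(\<eta> \<swarrow> \<psi>) \<circ> (\<psi> \<swarrow> \<phi>) \<sqsubseteq> \<eta> \<swarrow> \<phi>\<close> and \<open>(\<eta> \<searrow> \<psi>) \<circ> (\<psi> \<searrow> \<phi>) \<sqsubseteq> \<eta> \<searrow> \<phi>\<close>.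
  The last two are the composition laws of \<open>PA\<close> and \<open>P\<dagger>B\<close>. Transposed once more, they give the
  functoriality of the two Isbell maps: for example, \<open>\<nu> \<swarrow> \<mu> \<sqsubseteq> (\<phi> \<swarrow> \<nu>) \<searrow> (\<phi> \<swarrow> \<mu>)\<close> is
  \<open>(\<phi> \<swarrow> \<nu>) \<circ> (\<nu> \<swarrow> \<mu>) \<sqsubseteq> \<phi> \<swarrow> \<mu>\<close>. The unit \<open>\<mu> \<sqsubseteq> (\<phi> \<swarrow> \<mu>) \<searrow> \<phi>\<close> is the transpose of
  \<open>(\<phi> \<swarrow> \<mu>) \<circ> \<mu> \<sqsubseteq> \<phi>\<close>. The counit is \<open>\<lambda> \<sqsubseteq> \<phi> \<swarrow> (\<lambda> \<searrow> \<phi>)\<close> as an inequality of distributors, the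
  transpose of \<open>\<lambda> \<circ> (\<lambda> \<searrow> \<phi>) \<sqsubseteq> \<phi>\<close>; the reversed order of \<open>P\<dagger>B\<close> gives it the direction required
  of a counit.
\<close>

section \<open>Monotone composition and residuals of arrows\<close>

context quantaloid
begin

lemma Hom_trans:
  assumes "f \<sqsubseteq>\<^bsub>Hom Q A B\<^esub> g" "g \<sqsubseteq>\<^bsub>Hom Q A B\<^esub> h" "A \<in> Ob Q" "B \<in> Ob Q"
    "f \<in> arrows Q A B" "g \<in> arrows Q A B" "h \<in> arrows Q A B"
  shows "f \<sqsubseteq>\<^bsub>Hom Q A B\<^esub> h"
proof -
  interpret L: complete_lattice "Hom Q A B" by (rule complete_lattice_Hom) fact+
  show ?thesis using assms L.le_trans by blast
qed

lemma Hom_refl: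
  assumes "A \<in> Ob Q" "B \<in> Ob Q" "f \<in> arrows Q A B"
  shows "f \<sqsubseteq>\<^bsub>Hom Q A B\<^esub> f"
proof -
  interpret L: complete_lattice "Hom Q A B" by (rule complete_lattice_Hom) fact+
  show ?thesis using assms by simp
qed

lemma Sup_pair_eq_larger:
  assumes "f \<sqsubseteq>\<^bsub>Hom Q A B\<^esub> f'" "A \<in> Ob Q" "B \<in> Ob Q" "f \<in> arrows Q A B" "f' \<in> arrows Q A B"
  shows "\<Squnion>\<^bsub>Hom Q A B\<^esub> {f, f'} = f'"
proof -
  interpret L: complete_lattice "Hom Q A B" by (rule complete_lattice_Hom) fact+
  have "{f, f'} \<subseteq> arrows Q A B" using assms by auto
  then show ?thesis
    using assms L.sup_upper[of "{f, f'}" f'] L.sup_least[of "{f, f'}" f'] L.sup_closed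
    by (intro L.le_antisym) auto
qed

text \<open>Monotonicity is the case of preservation of joins for the join \<open>f \<squnion> f' = f'\<close>.\<close>

lemma Comp_mono_right:
  assumes "f \<sqsubseteq>\<^bsub>Hom Q A B\<^esub> f'" "A \<in> Ob Q" "B \<in> Ob Q" "C \<in> Ob Q"
    "f \<in> arrows Q A B" "f' \<in> arrows Q A B" "g \<in> arrows Q B C"
  shows "Comp Q A B C g f \<sqsubseteq>\<^bsub>Hom Q A C\<^esub> Comp Q A B C g f'"
proof -
  interpret L: complete_lattice "Hom Q A C" by (rule complete_lattice_Hom) fact+
  have "Comp Q A B C g f' = \<Squnion>\<^bsub>Hom Q A C\<^esub> ((\<lambda>f. Comp Q A B C g f) ` {f, f'})"
    using Comp_Sup_right[of A B C g "{f, f'}"] Sup_pair_eq_larger[OF assms(1)] assms by simp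
  moreover have "(\<lambda>f. Comp Q A B C g f) ` {f, f'} \<subseteq> arrows Q A C"
    using assms Comp_closed by auto
  ultimately show ?thesis using L.sup_upper[of "(\<lambda>f. Comp Q A B C g f) ` {f, f'}"] by auto
qed

lemma Comp_mono_left:
  assumes "g \<sqsubseteq>\<^bsub>Hom Q B C\<^esub> g'" "A \<in> Ob Q" "B \<in> Ob Q" "C \<in> Ob Q"
    "f \<in> arrows Q A B" "g \<in> arrows Q B C" "g' \<in> arrows Q B C"
  shows "Comp Q A B C g f \<sqsubseteq>\<^bsub>Hom Q A C\<^esub> Comp Q A B C g' f"
proof -
  interpret L: complete_lattice "Hom Q A C" by (rule complete_lattice_Hom) fact+
  have "Comp Q A B C g' f = \<Squnion>\<^bsub>Hom Q A C\<^esub> ((\<lambda>g. Comp Q A B C g f) ` {g, g'})"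
    using Comp_Sup_left[of A B C f "{g, g'}"] Sup_pair_eq_larger[OF assms(1)] assms by simp
  moreover have "(\<lambda>g. Comp Q A B C g f) ` {g, g'} \<subseteq> arrows Q A C"
    using assms Comp_closed by auto
  ultimately show ?thesis using L.sup_upper[of "(\<lambda>g. Comp Q A B C g f) ` {g, g'}"] by auto
qed

lemma lres_closed:
  assumes "A \<in> Ob Q" "B \<in> Ob Q" "X \<in> Ob Q" "f \<in> arrows Q A B" "g \<in> arrows Q A X"
  shows "lres Q A B X g f \<in> arrows Q B X"
  using lres_greatest[OF assms] by (auto simp: greatest_def)

lemma rres_closed:
  assumes "A \<in> Ob Q" "B \<in> Ob Q" "X \<in> Ob Q" "f \<in> arrows Q A B" "g \<in> arrows Q X B"
  shows "rres Q A B X f g \<in> arrows Q X A"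
  using rres_greatest[OF assms] by (auto simp: greatest_def)

lemma le_lres_iff:
  assumes "A \<in> Ob Q" "B \<in> Ob Q" "X \<in> Ob Q" "f \<in> arrows Q A B" "g \<in> arrows Q A X"
    "h \<in> arrows Q B X"
  shows "h \<sqsubseteq>\<^bsub>Hom Q B X\<^esub> lres Q A B X g f \<longleftrightarrow> Comp Q A B X h f \<sqsubseteq>\<^bsub>Hom Q A X\<^esub> g"
proof
  have cl: "lres Q A B X g f \<in> arrows Q B X" by (rule lres_closed) fact+
  have ev: "Comp Q A B X (lres Q A B X g f) f \<sqsubseteq>\<^bsub>Hom Q A X\<^esub> g"
    using lres_greatest[OF assms(1-5)] by (auto simp: greatest_def)
  assume "h \<sqsubseteq>\<^bsub>Hom Q B X\<^esub> lres Q A B X g f"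
  then have "Comp Q A B X h f \<sqsubseteq>\<^bsub>Hom Q A X\<^esub> Comp Q A B X (lres Q A B X g f) f"
    using assms cl by (intro Comp_mono_left)
  from Hom_trans[OF this ev] show "Comp Q A B X h f \<sqsubseteq>\<^bsub>Hom Q A X\<^esub> g"
    using assms cl Comp_closed by simp
next
  assume "Comp Q A B X h f \<sqsubseteq>\<^bsub>Hom Q A X\<^esub> g"
  then show "h \<sqsubseteq>\<^bsub>Hom Q B X\<^esub> lres Q A B X g f"
    using lres_greatest[OF assms(1-5)] assms(6) by (auto simp: greatest_def)
qed

lemma le_rres_iff:
  assumes "A \<in> Ob Q" "B \<in> Ob Q" "X \<in> Ob Q" "f \<in> arrows Q A B" "g \<in> arrows Q X B"
    "h \<in> arrows Q X A"
  shows "h \<sqsubseteq>\<^bsub>Hom Q X A\<^esub> rres Q A B X f g \<longleftrightarrow> Comp Q X A B f h \<sqsubseteq>\<^bsub>Hom Q X B\<^esub> g"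
proof
  have cl: "rres Q A B X f g \<in> arrows Q X A" by (rule rres_closed) fact+
  have ev: "Comp Q X A B f (rres Q A B X f g) \<sqsubseteq>\<^bsub>Hom Q X B\<^esub> g"
    using rres_greatest[OF assms(1-5)] by (auto simp: greatest_def)
  assume "h \<sqsubseteq>\<^bsub>Hom Q X A\<^esub> rres Q A B X f g"
  then have "Comp Q X A B f h \<sqsubseteq>\<^bsub>Hom Q X B\<^esub> Comp Q X A B f (rres Q A B X f g)"
    using assms cl by (intro Comp_mono_right)
  from Hom_trans[OF this ev] show "Comp Q X A B f h \<sqsubseteq>\<^bsub>Hom Q X B\<^esub> g"
    using assms cl Comp_closed by simp
next
  assume "Comp Q X A B f h \<sqsubseteq>\<^bsub>Hom Q X B\<^esub> g"
  then show "h \<sqsubseteq>\<^bsub>Hom Q X A\<^esub> rres Q A B X f g"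
    using rres_greatest[OF assms(1-5)] assms(6) by (auto simp: greatest_def)
qed

lemma Inf_closed:
  assumes "A \<in> Ob Q" "B \<in> Ob Q" "S \<subseteq> arrows Q A B"
  shows "\<Sqinter>\<^bsub>Hom Q A B\<^esub> S \<in> arrows Q A B"
proof -
  interpret L: complete_lattice "Hom Q A B" by (rule complete_lattice_Hom) fact+
  show ?thesis using assms by simp
qed

lemma le_Inf_iff:
  assumes "A \<in> Ob Q" "B \<in> Ob Q" "S \<subseteq> arrows Q A B" "h \<in> arrows Q A B"
  shows "h \<sqsubseteq>\<^bsub>Hom Q A B\<^esub> \<Sqinter>\<^bsub>Hom Q A B\<^esub> S \<longleftrightarrow> (\<forall>s\<in>S. h \<sqsubseteq>\<^bsub>Hom Q A B\<^esub> s)"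
proof -
  interpret L: complete_lattice "Hom Q A B" by (rule complete_lattice_Hom) fact+
  have "h \<sqsubseteq>\<^bsub>Hom Q A B\<^esub> s" if "h \<sqsubseteq>\<^bsub>Hom Q A B\<^esub> \<Sqinter>\<^bsub>Hom Q A B\<^esub> S" "s \<in> S" for s
    using Hom_trans[OF that(1) L.inf_lower[OF assms(3) that(2)]] assms that(2) L.inf_closed by blast
  moreover have "h \<sqsubseteq>\<^bsub>Hom Q A B\<^esub> \<Sqinter>\<^bsub>Hom Q A B\<^esub> S" if "\<forall>s\<in>S. h \<sqsubseteq>\<^bsub>Hom Q A B\<^esub> s"
    using L.inf_greatest[OF assms(3,4)] that by blast
  ultimately show ?thesis by blast
qed


section \<open>Residuals of distributors\<close>

lemma distributor_ty:
  assumes "distributor Q A B \<phi>"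
  shows "x \<in> obj A \<Longrightarrow> ty A x \<in> Ob Q" and "y \<in> obj B \<Longrightarrow> ty B y \<in> Ob Q"
  using assms by (auto simp: distributor_def qcategory_def)

lemma distributor_closed:
  assumes "distributor Q A B \<phi>" "x \<in> obj A" "y \<in> obj B"
  shows "\<phi> x y \<in> arrows Q (ty A x) (ty B y)"
  using assms by (auto simp: distributor_def PiE_iff)

lemma qcategory_arr_closed:
  assumes "qcategory Q A" "x \<in> obj A" "y \<in> obj A"
  shows "arr A x y \<in> arrows Q (ty A x) (ty A y)"
  using assms by (auto simp: qcategory_def)

lemma dist_lres_closed:
  assumes "distributor Q A B \<phi>" "distributor Q A C \<eta>" "y \<in> obj B" "z \<in> obj C"
  shows "dist_lres Q A B C \<eta> \<phi> y z \<in> arrows Q (ty B y) (ty C z)"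
  using assms distributor_ty[OF assms(1)] distributor_ty[OF assms(2)]
    distributor_closed[OF assms(1)] distributor_closed[OF assms(2)]
  by (auto simp: dist_lres_def intro!: Inf_closed lres_closed)

lemma dist_rres_closed:
  assumes "distributor Q B C \<psi>" "distributor Q A C \<eta>" "x \<in> obj A" "y \<in> obj B"
  shows "dist_rres Q A B C \<psi> \<eta> x y \<in> arrows Q (ty A x) (ty B y)"
  using assms distributor_ty[OF assms(1)] distributor_ty[OF assms(2)]
    distributor_closed[OF assms(1)] distributor_closed[OF assms(2)]
  by (auto simp: dist_rres_def intro!: Inf_closed rres_closed)

text \<open>
  The universal property for a single arrow \<open>h\<close> instead of a whole distributor. This form can be
  applied to identities and composites in \<open>Q\<close>, which is how hom-arrows of presheaf categories are
  compared.
\<close>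

lemma le_dist_lres_iff:
  assumes \<phi>: "distributor Q A B \<phi>" and \<eta>: "distributor Q A C \<eta>"
    and yz: "y \<in> obj B" "z \<in> obj C" and h: "h \<in> arrows Q (ty B y) (ty C z)"
  shows "h \<sqsubseteq>\<^bsub>Hom Q (ty B y) (ty C z)\<^esub> dist_lres Q A B C \<eta> \<phi> y z \<longleftrightarrow>
    (\<forall>x\<in>obj A. Comp Q (ty A x) (ty B y) (ty C z) h (\<phi> x y) \<sqsubseteq>\<^bsub>Hom Q (ty A x) (ty C z)\<^esub> \<eta> x z)"
proof -
  have sub: "(\<lambda>x. lres Q (ty A x) (ty B y) (ty C z) (\<eta> x z) (\<phi> x y)) ` obj A
      \<subseteq> arrows Q (ty B y) (ty C z)"
    using yz distributor_ty[OF \<phi>] distributor_ty[OF \<eta>]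
      distributor_closed[OF \<phi>] distributor_closed[OF \<eta>] by (auto intro!: lres_closed)
  show ?thesis
    using yz h distributor_ty[OF \<phi>] distributor_ty[OF \<eta>]
      distributor_closed[OF \<phi>] distributor_closed[OF \<eta>]
    by (simp add: dist_lres_def le_Inf_iff[OF _ _ sub h] le_lres_iff)
qed

lemma le_dist_rres_iff:
  assumes \<psi>: "distributor Q B C \<psi>" and \<eta>: "distributor Q A C \<eta>"
    and xy: "x \<in> obj A" "y \<in> obj B" and h: "h \<in> arrows Q (ty A x) (ty B y)"
  shows "h \<sqsubseteq>\<^bsub>Hom Q (ty A x) (ty B y)\<^esub> dist_rres Q A B C \<psi> \<eta> x y \<longleftrightarrow>
    (\<forall>z\<in>obj C. Comp Q (ty A x) (ty B y) (ty C z) (\<psi> y z) h \<sqsubseteq>\<^bsub>Hom Q (ty A x) (ty C z)\<^esub> \<eta> x z)"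
proof -
  have sub: "(\<lambda>z. rres Q (ty B y) (ty C z) (ty A x) (\<psi> y z) (\<eta> x z)) ` obj C
      \<subseteq> arrows Q (ty A x) (ty B y)"
    using xy distributor_ty[OF \<psi>] distributor_ty[OF \<eta>]
      distributor_closed[OF \<psi>] distributor_closed[OF \<eta>] by (auto intro!: rres_closed)
  show ?thesis
    using xy h distributor_ty[OF \<psi>] distributor_ty[OF \<eta>]
      distributor_closed[OF \<psi>] distributor_closed[OF \<eta>]
    by (simp add: dist_rres_def le_Inf_iff[OF _ _ sub h] le_rres_iff)
qed

lemma dist_lres_eval:
  assumes "distributor Q A B \<phi>" "distributor Q A C \<eta>" "x \<in> obj A" "y \<in> obj B" "z \<in> obj C"
  shows "Comp Q (ty A x) (ty B y) (ty C z) (dist_lres Q A B C \<eta> \<phi> y z) (\<phi> x y)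
    \<sqsubseteq>\<^bsub>Hom Q (ty A x) (ty C z)\<^esub> \<eta> x z"
proof -
  have cl: "dist_lres Q A B C \<eta> \<phi> y z \<in> arrows Q (ty B y) (ty C z)"
    using assms by (intro dist_lres_closed)
  have "dist_lres Q A B C \<eta> \<phi> y z \<sqsubseteq>\<^bsub>Hom Q (ty B y) (ty C z)\<^esub> dist_lres Q A B C \<eta> \<phi> y z"
    using assms cl by (intro Hom_refl) (auto dest: distributor_ty)
  then show ?thesis
    using le_dist_lres_iff[OF assms(1,2,4,5) cl] assms(3) by blast
qed

lemma dist_rres_eval:
  assumes "distributor Q B C \<psi>" "distributor Q A C \<eta>" "x \<in> obj A" "y \<in> obj B" "z \<in> obj C"
  shows "Comp Q (ty A x) (ty B y) (ty C z) (\<psi> y z) (dist_rres Q A B C \<psi> \<eta> x y)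
    \<sqsubseteq>\<^bsub>Hom Q (ty A x) (ty C z)\<^esub> \<eta> x z"
proof -
  have cl: "dist_rres Q A B C \<psi> \<eta> x y \<in> arrows Q (ty A x) (ty B y)"
    using assms by (intro dist_rres_closed)
  have "dist_rres Q A B C \<psi> \<eta> x y \<sqsubseteq>\<^bsub>Hom Q (ty A x) (ty B y)\<^esub> dist_rres Q A B C \<psi> \<eta> x y"
    using assms cl by (intro Hom_refl) (auto dest: distributor_ty)
  then show ?thesis
    using le_dist_rres_iff[OF assms(1,2,3,4) cl] assms(5) by blast
qed

text \<open>
  The two ways in which a bound on a three-fold composite \<open>h \<circ> g \<circ> f\<close> arises from a bound on an
  inner composite.
\<close>

lemma Comp_bound_left:
  assumes gf: "Comp Q A B C g f \<sqsubseteq>\<^bsub>Hom Q A C\<^esub> u" and hu: "Comp Q A C D h u \<sqsubseteq>\<^bsub>Hom Q A D\<^esub> v"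
    and obs: "A \<in> Ob Q" "B \<in> Ob Q" "C \<in> Ob Q" "D \<in> Ob Q"
    and ars: "f \<in> arrows Q A B" "g \<in> arrows Q B C" "h \<in> arrows Q C D"
      "u \<in> arrows Q A C" "v \<in> arrows Q A D"
  shows "Comp Q A B D (Comp Q B C D h g) f \<sqsubseteq>\<^bsub>Hom Q A D\<^esub> v"
proof -
  have "Comp Q A C D h (Comp Q A B C g f) \<sqsubseteq>\<^bsub>Hom Q A D\<^esub> Comp Q A C D h u"
    using gf obs ars Comp_closed by (intro Comp_mono_right) auto
  from Hom_trans[OF this hu] show ?thesis
    using obs ars Comp_closed by (simp add: Comp_assoc)
qed

lemma Comp_bound_right:
  assumes hg: "Comp Q B C D h g \<sqsubseteq>\<^bsub>Hom Q B D\<^esub> u" and uf: "Comp Q A B D u f \<sqsubseteq>\<^bsub>Hom Q A D\<^esub> v"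
    and obs: "A \<in> Ob Q" "B \<in> Ob Q" "C \<in> Ob Q" "D \<in> Ob Q"
    and ars: "f \<in> arrows Q A B" "g \<in> arrows Q B C" "h \<in> arrows Q C D"
      "u \<in> arrows Q B D" "v \<in> arrows Q A D"
  shows "Comp Q A C D h (Comp Q A B C g f) \<sqsubseteq>\<^bsub>Hom Q A D\<^esub> v"
proof -
  have "Comp Q A B D (Comp Q B C D h g) f \<sqsubseteq>\<^bsub>Hom Q A D\<^esub> Comp Q A B D u f"
    using hg obs ars Comp_closed by (intro Comp_mono_left) auto
  from Hom_trans[OF this uf] show ?thesis
    using obs ars Comp_closed by (simp add: Comp_assoc[symmetric])
qed

text \<open>
  Transposing, each inequality below bounds \<open>(\<eta> \<swarrow> \<psi>) \<circ> (\<psi> \<swarrow> \<phi>) \<circ> \<phi>\<close> or \<open>\<eta> \<circ> (\<eta> \<searrow> \<psi>) \<circ> (\<psi> \<searrow> \<phi>)\<close> by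
  evaluating twice.
\<close>

lemma dist_lres_comp:
  assumes \<phi>: "distributor Q A B \<phi>" and \<psi>: "distributor Q A C \<psi>" and \<eta>: "distributor Q A D \<eta>"
    and obs: "y \<in> obj B" "z \<in> obj C" "w \<in> obj D"
  shows "Comp Q (ty B y) (ty C z) (ty D w) (dist_lres Q A C D \<eta> \<psi> z w) (dist_lres Q A B C \<psi> \<phi> y z)
    \<sqsubseteq>\<^bsub>Hom Q (ty B y) (ty D w)\<^esub> dist_lres Q A B D \<eta> \<phi> y w"
proof -
  note t = distributor_ty[OF \<phi>] distributor_ty[OF \<psi>] distributor_ty[OF \<eta>]
  have cl: "dist_lres Q A C D \<eta> \<psi> z w \<in> arrows Q (ty C z) (ty D w)"
    "dist_lres Q A B C \<psi> \<phi> y z \<in> arrows Q (ty B y) (ty C z)"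
    using assms by (auto intro: dist_lres_closed)
  have "Comp Q (ty A x) (ty B y) (ty D w)
      (Comp Q (ty B y) (ty C z) (ty D w) (dist_lres Q A C D \<eta> \<psi> z w) (dist_lres Q A B C \<psi> \<phi> y z))
      (\<phi> x y) \<sqsubseteq>\<^bsub>Hom Q (ty A x) (ty D w)\<^esub> \<eta> x w" if x: "x \<in> obj A" for x
    by (rule Comp_bound_left[OF dist_lres_eval[OF \<phi> \<psi> x obs(1,2)] dist_lres_eval[OF \<psi> \<eta> x obs(2,3)]])
      (use x obs t cl distributor_closed[OF \<phi>] distributor_closed[OF \<psi>]
        distributor_closed[OF \<eta>] in auto)
  then show ?thesis
    using obs t cl Comp_closed by (subst le_dist_lres_iff[OF \<phi> \<eta>]) auto
qed

lemma dist_rres_comp: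
  assumes \<phi>: "distributor Q A D \<phi>" and \<psi>: "distributor Q B D \<psi>" and \<eta>: "distributor Q C D \<eta>"
    and obs: "x \<in> obj A" "y \<in> obj B" "z \<in> obj C"
  shows "Comp Q (ty A x) (ty B y) (ty C z) (dist_rres Q B C D \<eta> \<psi> y z) (dist_rres Q A B D \<psi> \<phi> x y)
    \<sqsubseteq>\<^bsub>Hom Q (ty A x) (ty C z)\<^esub> dist_rres Q A C D \<eta> \<phi> x z"
proof -
  note t = distributor_ty[OF \<phi>] distributor_ty[OF \<psi>] distributor_ty[OF \<eta>]
  have cl: "dist_rres Q B C D \<eta> \<psi> y z \<in> arrows Q (ty B y) (ty C z)"
    "dist_rres Q A B D \<psi> \<phi> x y \<in> arrows Q (ty A x) (ty B y)"
    using assms by (auto intro: dist_rres_closed)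
  have "Comp Q (ty A x) (ty C z) (ty D w) (\<eta> z w)
      (Comp Q (ty A x) (ty B y) (ty C z) (dist_rres Q B C D \<eta> \<psi> y z) (dist_rres Q A B D \<psi> \<phi> x y))
      \<sqsubseteq>\<^bsub>Hom Q (ty A x) (ty D w)\<^esub> \<phi> x w" if w: "w \<in> obj D" for w
    by (rule Comp_bound_right[OF dist_rres_eval[OF \<eta> \<psi> obs(2,3) w] dist_rres_eval[OF \<psi> \<phi> obs(1,2) w]])
      (use w obs t cl distributor_closed[OF \<phi>] distributor_closed[OF \<psi>]
        distributor_closed[OF \<eta>] in auto)
  then show ?thesis
    using obs t cl Comp_closed by (subst le_dist_rres_iff[OF \<eta> \<phi>]) auto
qed

text \<open>
  The residual \<open>\<eta> \<swarrow> \<phi>\<close> inherits its left action from \<open>\<eta>\<close>, by \<open>c \<circ> (\<eta> \<swarrow> \<phi>) \<circ> \<phi> \<sqsubseteq> c \<circ> \<eta> \<sqsubseteq> \<eta>\<close> for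
  hom-arrows \<open>c\<close> of \<open>C\<close>, and its right action from the left action on \<open>\<phi>\<close>, by
  \<open>(\<eta> \<swarrow> \<phi>) \<circ> b \<circ> \<phi> \<sqsubseteq> (\<eta> \<swarrow> \<phi>) \<circ> \<phi> \<sqsubseteq> \<eta>\<close> for hom-arrows \<open>b\<close> of \<open>B\<close>. The residual \<open>\<psi> \<searrow> \<eta>\<close> is dual.
\<close>

lemma distributor_dist_lres:
  assumes \<phi>: "distributor Q A B \<phi>" and \<eta>: "distributor Q A C \<eta>"
  shows "distributor Q B C (dist_lres Q A B C \<eta> \<phi>)"
proof -
  let ?r = "dist_lres Q A B C \<eta> \<phi>"
  note t = distributor_ty[OF \<phi>] distributor_ty[OF \<eta>]
  note d = distributor_closed[OF \<phi>] distributor_closed[OF \<eta>] dist_lres_closed[OF \<phi> \<eta>]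
  have qB: "qcategory Q B" and qC: "qcategory Q C"
    using \<phi> \<eta> by (auto simp: distributor_def)
  note a = qcategory_arr_closed[OF qB] qcategory_arr_closed[OF qC]
  have \<phi>B: "Comp Q (ty A x) (ty B y) (ty B y') (arr B y y') (\<phi> x y)
      \<sqsubseteq>\<^bsub>Hom Q (ty A x) (ty B y')\<^esub> \<phi> x y'" if "x \<in> obj A" "y \<in> obj B" "y' \<in> obj B" for x y y'
    using \<phi> that by (auto simp: distributor_def)
  have \<eta>C: "Comp Q (ty A x) (ty C z) (ty C z') (arr C z z') (\<eta> x z)
      \<sqsubseteq>\<^bsub>Hom Q (ty A x) (ty C z')\<^esub> \<eta> x z'" if "x \<in> obj A" "z \<in> obj C" "z' \<in> obj C" for x z z'
    using \<eta> that by (auto simp: distributor_def)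
  have 1: "Comp Q (ty B y) (ty C z') (ty C z) (arr C z' z) (?r y z')
      \<sqsubseteq>\<^bsub>Hom Q (ty B y) (ty C z)\<^esub> ?r y z"
    if obs: "y \<in> obj B" "z' \<in> obj C" "z \<in> obj C" for y z' z
  proof (subst le_dist_lres_iff[OF \<phi> \<eta>], goal_cases)
    \<comment> \<open>The transposed inequality; the other goals are the typing conditions of the transposition.\<close>
    case 4
    show ?case
    proof
      fix x assume x: "x \<in> obj A"
      show "Comp Q (ty A x) (ty B y) (ty C z)
          (Comp Q (ty B y) (ty C z') (ty C z) (arr C z' z) (?r y z')) (\<phi> x y)
          \<sqsubseteq>\<^bsub>Hom Q (ty A x) (ty C z)\<^esub> \<eta> x z"
        by (rule Comp_bound_left[OF dist_lres_eval[OF \<phi> \<eta> x obs(1,2)] \<eta>C[OF x obs(2,3)]])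
          (use x obs t d a in auto)
    qed
  qed (use obs t d a Comp_closed in auto)
  have 2: "Comp Q (ty B y) (ty B y') (ty C z) (?r y' z) (arr B y y')
      \<sqsubseteq>\<^bsub>Hom Q (ty B y) (ty C z)\<^esub> ?r y z"
    if obs: "y \<in> obj B" "y' \<in> obj B" "z \<in> obj C" for y y' z
  proof (subst le_dist_lres_iff[OF \<phi> \<eta>], goal_cases)
    case 4
    show ?case
    proof
      fix x assume x: "x \<in> obj A"
      show "Comp Q (ty A x) (ty B y) (ty C z)
          (Comp Q (ty B y) (ty B y') (ty C z) (?r y' z) (arr B y y')) (\<phi> x y)
          \<sqsubseteq>\<^bsub>Hom Q (ty A x) (ty C z)\<^esub> \<eta> x z"
        by (rule Comp_bound_left[OF \<phi>B[OF x obs(1,2)] dist_lres_eval[OF \<phi> \<eta> x obs(2,3)]])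
          (use x obs t d a in auto)
    qed
  qed (use obs t d a Comp_closed in auto)
  have 3: "?r \<in> (\<Pi>\<^sub>E y\<in>obj B. \<Pi>\<^sub>E z\<in>obj C. arrows Q (ty B y) (ty C z))"
    using d(3) by (auto simp: PiE_iff dist_lres_def)
  show ?thesis
    unfolding distributor_def using qB qC 1 2 3 by blast
qed

lemma distributor_dist_rres:
  assumes \<psi>: "distributor Q B C \<psi>" and \<eta>: "distributor Q A C \<eta>"
  shows "distributor Q A B (dist_rres Q A B C \<psi> \<eta>)"
proof -
  let ?r = "dist_rres Q A B C \<psi> \<eta>"
  note t = distributor_ty[OF \<psi>] distributor_ty[OF \<eta>]
  note d = distributor_closed[OF \<psi>] distributor_closed[OF \<eta>] dist_rres_closed[OF \<psi> \<eta>]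
  have qA: "qcategory Q A" and qB: "qcategory Q B"
    using \<psi> \<eta> by (auto simp: distributor_def)
  note a = qcategory_arr_closed[OF qA] qcategory_arr_closed[OF qB]
  have \<psi>B: "Comp Q (ty B y) (ty B y') (ty C z) (\<psi> y' z) (arr B y y')
      \<sqsubseteq>\<^bsub>Hom Q (ty B y) (ty C z)\<^esub> \<psi> y z" if "y \<in> obj B" "y' \<in> obj B" "z \<in> obj C" for y y' z
    using \<psi> that by (auto simp: distributor_def)
  have \<eta>A: "Comp Q (ty A x) (ty A x') (ty C z) (\<eta> x' z) (arr A x x')
      \<sqsubseteq>\<^bsub>Hom Q (ty A x) (ty C z)\<^esub> \<eta> x z" if "x \<in> obj A" "x' \<in> obj A" "z \<in> obj C" for x x' z
    using \<eta> that by (auto simp: distributor_def)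
  have 1: "Comp Q (ty A x) (ty B y') (ty B y) (arr B y' y) (?r x y')
      \<sqsubseteq>\<^bsub>Hom Q (ty A x) (ty B y)\<^esub> ?r x y"
    if obs: "x \<in> obj A" "y' \<in> obj B" "y \<in> obj B" for x y' y
  proof (subst le_dist_rres_iff[OF \<psi> \<eta>], goal_cases)
    case 4
    show ?case
    proof
      fix z assume z: "z \<in> obj C"
      show "Comp Q (ty A x) (ty B y) (ty C z) (\<psi> y z)
          (Comp Q (ty A x) (ty B y') (ty B y) (arr B y' y) (?r x y'))
          \<sqsubseteq>\<^bsub>Hom Q (ty A x) (ty C z)\<^esub> \<eta> x z"
        by (rule Comp_bound_right[OF \<psi>B[OF obs(2,3) z] dist_rres_eval[OF \<psi> \<eta> obs(1,2) z]])
          (use z obs t d a in auto)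
    qed
  qed (use obs t d a Comp_closed in auto)
  have 2: "Comp Q (ty A x) (ty A x') (ty B y) (?r x' y) (arr A x x')
      \<sqsubseteq>\<^bsub>Hom Q (ty A x) (ty B y)\<^esub> ?r x y"
    if obs: "x \<in> obj A" "x' \<in> obj A" "y \<in> obj B" for x x' y
  proof (subst le_dist_rres_iff[OF \<psi> \<eta>], goal_cases)
    case 4
    show ?case
    proof
      fix z assume z: "z \<in> obj C"
      show "Comp Q (ty A x) (ty B y) (ty C z) (\<psi> y z)
          (Comp Q (ty A x) (ty A x') (ty B y) (?r x' y) (arr A x x'))
          \<sqsubseteq>\<^bsub>Hom Q (ty A x) (ty C z)\<^esub> \<eta> x z"
        by (rule Comp_bound_right[OF dist_rres_eval[OF \<psi> \<eta> obs(2,3) z] \<eta>A[OF obs(1,2) z]])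
          (use z obs t d a in auto)
    qed
  qed (use obs t d a Comp_closed in auto)
  have 3: "?r \<in> (\<Pi>\<^sub>E x\<in>obj A. \<Pi>\<^sub>E y\<in>obj B. arrows Q (ty A x) (ty B y))"
    using d(3) by (auto simp: PiE_iff dist_rres_def)
  show ?thesis
    unfolding distributor_def using qA qB 1 2 3 by blast
qed


section \<open>The categories of presheaves and copresheaves\<close>

lemma star_simps [simp]:
  "obj (star Q X) = UNIV" "ty (star Q X) u = X" "arr (star Q X) u v = One Q X"
  by (simp_all add: star_def)

lemma presheaves_simps [simp]:
  "(X, \<mu>) \<in> obj (presheaves Q A) \<longleftrightarrow> X \<in> Ob Q \<and> distributor Q A (star Q X) \<mu>"
  "ty (presheaves Q A) (X, \<mu>) = X"
  "arr (presheaves Q A) (X, \<mu>) (Y, \<nu>) = dist_lres Q A (star Q X) (star Q Y) \<nu> \<mu> () ()"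
  by (simp_all add: presheaves_def)

lemma copresheaves_simps [simp]:
  "(X, \<mu>) \<in> obj (copresheaves Q A) \<longleftrightarrow> X \<in> Ob Q \<and> distributor Q (star Q X) A \<mu>"
  "ty (copresheaves Q A) (X, \<mu>) = X"
  "arr (copresheaves Q A) (X, \<mu>) (Y, \<nu>) = dist_rres Q (star Q X) (star Q Y) A \<nu> \<mu> () ()"
  by (simp_all add: copresheaves_def)

text \<open>
  Under the identity arrow the universal property of \<open>\<nu> \<swarrow> \<mu>\<close> becomes the pointwise order, so the
  underlying order of \<open>PA\<close> is pointwise and that of \<open>P\<dagger>A\<close> is its reverse. Identities, the unit
  and the counit are all obtained from these two lemmas.
\<close>

lemma presheaf_One_le_iff:
  assumes "X \<in> Ob Q" "distributor Q A (star Q X) \<mu>" "distributor Q A (star Q X) \<nu>"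
  shows "One Q X \<sqsubseteq>\<^bsub>Hom Q X X\<^esub> dist_lres Q A (star Q X) (star Q X) \<nu> \<mu> () () \<longleftrightarrow>
    (\<forall>x\<in>obj A. \<mu> x () \<sqsubseteq>\<^bsub>Hom Q (ty A x) X\<^esub> \<nu> x ())"
proof -
  have "Comp Q (ty A x) X X (One Q X) (\<mu> x ()) = \<mu> x ()" if "x \<in> obj A" for x
    using assms that distributor_ty(1)[OF assms(2)] distributor_closed[OF assms(2), of x "()"]
    by (intro Comp_One_left) auto
  then show ?thesis
    using le_dist_lres_iff[OF assms(2,3), of "()" "()" "One Q X"] assms(1) One_closed by simp
qed

lemma copresheaf_One_le_iff:
  assumes "X \<in> Ob Q" "distributor Q (star Q X) A \<mu>" "distributor Q (star Q X) A \<nu>"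
  shows "One Q X \<sqsubseteq>\<^bsub>Hom Q X X\<^esub> dist_rres Q (star Q X) (star Q X) A \<nu> \<mu> () () \<longleftrightarrow>
    (\<forall>x\<in>obj A. \<nu> () x \<sqsubseteq>\<^bsub>Hom Q X (ty A x)\<^esub> \<mu> () x)"
proof -
  have "Comp Q X X (ty A x) (\<nu> () x) (One Q X) = \<nu> () x" if "x \<in> obj A" for x
    using assms that distributor_ty(2)[OF assms(2)] distributor_closed[OF assms(3), of "()" x]
    by (intro Comp_One_right) auto
  then show ?thesis
    using le_dist_rres_iff[OF assms(3,2), of "()" "()" "One Q X"] assms(1) One_closed by simp
qed

lemma qcategory_presheaves: "qcategory Q (presheaves Q A)"
  unfolding qcategory_def
proof (intro conjI ballI; clarsimp)
  fix X \<mu> Y \<nu>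
  assume "X \<in> Ob Q" "Y \<in> Ob Q" "distributor Q A (star Q X) \<mu>" "distributor Q A (star Q Y) \<nu>"
  then show "dist_lres Q A (star Q X) (star Q Y) \<nu> \<mu> () () \<in> arrows Q X Y"
    using dist_lres_closed[of A "star Q X" \<mu> "star Q Y" \<nu> "()" "()"] by simp
next
  fix X \<mu>
  assume *: "X \<in> Ob Q" "distributor Q A (star Q X) \<mu>"
  show "One Q X \<sqsubseteq>\<^bsub>Hom Q X X\<^esub> dist_lres Q A (star Q X) (star Q X) \<mu> \<mu> () ()"
    using * distributor_ty(1)[OF *(2)] distributor_closed[OF *(2), of _ "()"]
    by (simp add: presheaf_One_le_iff Hom_refl)
next
  fix X \<mu> Y \<nu> Z \<rho>
  assume "distributor Q A (star Q X) \<mu>" "distributor Q A (star Q Y) \<nu>"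
    "distributor Q A (star Q Z) \<rho>"
  then show "Comp Q X Y Z (dist_lres Q A (star Q Y) (star Q Z) \<rho> \<nu> () ())
      (dist_lres Q A (star Q X) (star Q Y) \<nu> \<mu> () ())
      \<sqsubseteq>\<^bsub>Hom Q X Z\<^esub> dist_lres Q A (star Q X) (star Q Z) \<rho> \<mu> () ()"
    using dist_lres_comp[of A "star Q X" \<mu> "star Q Y" \<nu> "star Q Z" \<rho> "()" "()" "()"] by simp
qed

lemma qcategory_copresheaves: "qcategory Q (copresheaves Q A)"
  unfolding qcategory_def
proof (intro conjI ballI; clarsimp)
  fix X \<mu> Y \<nu>
  assume "X \<in> Ob Q" "Y \<in> Ob Q" "distributor Q (star Q X) A \<mu>" "distributor Q (star Q Y) A \<nu>"
  then show "dist_rres Q (star Q X) (star Q Y) A \<nu> \<mu> () () \<in> arrows Q X Y"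
    using dist_rres_closed[of "star Q Y" A \<nu> "star Q X" \<mu> "()" "()"] by simp
next
  fix X \<mu>
  assume *: "X \<in> Ob Q" "distributor Q (star Q X) A \<mu>"
  show "One Q X \<sqsubseteq>\<^bsub>Hom Q X X\<^esub> dist_rres Q (star Q X) (star Q X) A \<mu> \<mu> () ()"
    using * distributor_ty(2)[OF *(2)] distributor_closed[OF *(2), of "()"]
    by (simp add: copresheaf_One_le_iff Hom_refl)
next
  fix X \<mu> Y \<nu> Z \<rho>
  assume "distributor Q (star Q X) A \<mu>" "distributor Q (star Q Y) A \<nu>"
    "distributor Q (star Q Z) A \<rho>"
  then show "Comp Q X Y Z (dist_rres Q (star Q Y) (star Q Z) A \<rho> \<nu> () ())
      (dist_rres Q (star Q X) (star Q Y) A \<nu> \<mu> () ())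
      \<sqsubseteq>\<^bsub>Hom Q X Z\<^esub> dist_rres Q (star Q X) (star Q Z) A \<rho> \<mu> () ()"
    using dist_rres_comp[of "star Q X" A \<mu> "star Q Y" \<nu> "star Q Z" \<rho> "()" "()" "()"] by simp
qed


section \<open>The Isbell adjunction\<close>

lemma isbell_up_apply:
  assumes "X \<in> Ob Q" "distributor Q A (star Q X) \<mu>"
  shows "isbell_up Q A B \<phi> (X, \<mu>) = (X, dist_lres Q A (star Q X) B \<phi> \<mu>)"
  using assms by (simp add: isbell_up_def)

lemma isbell_down_apply:
  assumes "X \<in> Ob Q" "distributor Q (star Q X) B \<nu>"
  shows "isbell_down Q A B \<phi> (X, \<nu>) = (X, dist_rres Q A (star Q X) B \<nu> \<phi>)"
  using assms by (simp add: isbell_down_def)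

text \<open>
  Functoriality of either map is the composition law of residuals (\<open>dist_lres_comp\<close> or
  \<open>dist_rres_comp\<close>), transposed once along the residual of the other kind.
\<close>

lemma qfunctor_isbell_up:
  assumes \<phi>: "distributor Q A B \<phi>"
  shows "qfunctor Q (presheaves Q A) (copresheaves Q B) (isbell_up Q A B \<phi>)"
proof -
  have "isbell_up Q A B \<phi> \<in> obj (presheaves Q A) \<rightarrow>\<^sub>E obj (copresheaves Q B)"
    by (auto simp: isbell_up_def distributor_dist_lres[OF _ \<phi>])
  moreover have "dist_lres Q A (star Q X) (star Q Y) \<nu> \<mu> () () \<sqsubseteq>\<^bsub>Hom Q X Y\<^esub>
      dist_rres Q (star Q X) (star Q Y) B
        (dist_lres Q A (star Q Y) B \<phi> \<nu>) (dist_lres Q A (star Q X) B \<phi> \<mu>) () ()"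
    if \<mu>: "distributor Q A (star Q X) \<mu>" and \<nu>: "distributor Q A (star Q Y) \<nu>" for X Y \<mu> \<nu>
  proof -
    have cl: "dist_lres Q A (star Q X) (star Q Y) \<nu> \<mu> () ()
        \<in> arrows Q (ty (star Q X) ()) (ty (star Q Y) ())"
      by (rule dist_lres_closed[OF \<mu> \<nu>]) simp_all
    show ?thesis
      using le_dist_rres_iff[OF distributor_dist_lres[OF \<nu> \<phi>] distributor_dist_lres[OF \<mu> \<phi>] _ _ cl]
        dist_lres_comp[OF \<mu> \<nu> \<phi>, of "()" "()"] by simp
  qed
  ultimately show ?thesis
    using qcategory_presheaves qcategory_copresheaves
    by (auto simp: qfunctor_def isbell_up_apply)
qed

lemma qfunctor_isbell_down:
  assumes \<phi>: "distributor Q A B \<phi>"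
  shows "qfunctor Q (copresheaves Q B) (presheaves Q A) (isbell_down Q A B \<phi>)"
proof -
  have "isbell_down Q A B \<phi> \<in> obj (copresheaves Q B) \<rightarrow>\<^sub>E obj (presheaves Q A)"
    by (auto simp: isbell_down_def distributor_dist_rres[OF _ \<phi>])
  moreover have "dist_rres Q (star Q X) (star Q Y) B \<nu> \<mu> () () \<sqsubseteq>\<^bsub>Hom Q X Y\<^esub>
      dist_lres Q A (star Q X) (star Q Y)
        (dist_rres Q A (star Q Y) B \<nu> \<phi>) (dist_rres Q A (star Q X) B \<mu> \<phi>) () ()"
    if \<mu>: "distributor Q (star Q X) B \<mu>" and \<nu>: "distributor Q (star Q Y) B \<nu>" for X Y \<mu> \<nu>
  proof -
    have cl: "dist_rres Q (star Q X) (star Q Y) B \<nu> \<mu> () ()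
        \<in> arrows Q (ty (star Q X) ()) (ty (star Q Y) ())"
      by (rule dist_rres_closed[OF \<nu> \<mu>]) simp_all
    show ?thesis
      using le_dist_lres_iff[OF distributor_dist_rres[OF \<mu> \<phi>] distributor_dist_rres[OF \<nu> \<phi>] _ _ cl]
        dist_rres_comp[OF \<phi> \<mu> \<nu>, of _ "()" "()"] by simp
  qed
  ultimately show ?thesis
    using qcategory_presheaves qcategory_copresheaves
    by (auto simp: qfunctor_def isbell_down_apply)
qed

lemma isbell_unit:
  assumes \<phi>: "distributor Q A B \<phi>" and X: "X \<in> Ob Q" and \<mu>: "distributor Q A (star Q X) \<mu>"
  shows "qcat_le Q (presheaves Q A) (X, \<mu>) (isbell_down Q A B \<phi> (isbell_up Q A B \<phi> (X, \<mu>)))"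
proof -
  note \<phi>\<mu> = distributor_dist_lres[OF \<mu> \<phi>]
  have "\<mu> x () \<sqsubseteq>\<^bsub>Hom Q (ty A x) X\<^esub> dist_rres Q A (star Q X) B (dist_lres Q A (star Q X) B \<phi> \<mu>) \<phi> x ()"
    if x: "x \<in> obj A" for x
    using le_dist_rres_iff[OF \<phi>\<mu> \<phi> x, of "()" "\<mu> x ()"] distributor_closed[OF \<mu> x, of "()"]
      dist_lres_eval[OF \<mu> \<phi> x, of "()"] by simp
  then show ?thesis
    using X presheaf_One_le_iff[OF X \<mu> distributor_dist_rres[OF \<phi>\<mu> \<phi>]]
    by (simp add: qcat_le_def isbell_up_apply[OF X \<mu>] isbell_down_apply[OF X \<phi>\<mu>])
qed

lemma isbell_counit:
  assumes \<phi>: "distributor Q A B \<phi>" and X: "X \<in> Ob Q" and \<nu>: "distributor Q (star Q X) B \<nu>"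
  shows "qcat_le Q (copresheaves Q B) (isbell_up Q A B \<phi> (isbell_down Q A B \<phi> (X, \<nu>))) (X, \<nu>)"
proof -
  note \<nu>\<phi> = distributor_dist_rres[OF \<nu> \<phi>]
  have "\<nu> () y \<sqsubseteq>\<^bsub>Hom Q X (ty B y)\<^esub> dist_lres Q A (star Q X) B \<phi> (dist_rres Q A (star Q X) B \<nu> \<phi>) () y"
    if y: "y \<in> obj B" for y
    using le_dist_lres_iff[OF \<nu>\<phi> \<phi> _ y, of "()" "\<nu> () y"] distributor_closed[OF \<nu> _ y, of "()"]
      dist_rres_eval[OF \<nu> \<phi> _ _ y, of _ "()"] by simp
  then show ?thesis
    using X copresheaf_One_le_iff[OF X distributor_dist_lres[OF \<nu>\<phi> \<phi>] \<nu>]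
    by (simp add: qcat_le_def isbell_down_apply[OF X \<nu>] isbell_up_apply[OF X \<nu>\<phi>])
qed

end

theorem proposition4p1:
  fixes Q :: "('o, 'm) quantaloid_data"
    and A :: "('o, 'm, 'a) qcat"
    and B :: "('o, 'm, 'b) qcat"
    and \<phi> :: "'a \<Rightarrow> 'b \<Rightarrow> 'm"
  assumes "quantaloid Q"
    and "qcategory Q A"
    and "qcategory Q B"
    and "distributor Q A B \<phi>"
  shows "qadjoint Q (presheaves Q A) (copresheaves Q B) (isbell_up Q A B \<phi>) (isbell_down Q A B \<phi>)"
proof -
  interpret quantaloid Q by fact
  note \<phi> = \<open>distributor Q A B \<phi>\<close>
  have "qfunctor_le Q (presheaves Q A) (presheaves Q A) (\<lambda>x\<in>obj (presheaves Q A). x)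
      (compose (obj (presheaves Q A)) (isbell_down Q A B \<phi>) (isbell_up Q A B \<phi>))"
    using isbell_unit[OF \<phi>] by (auto simp: qfunctor_le_def compose_def)
  moreover have "qfunctor_le Q (copresheaves Q B) (copresheaves Q B)
      (compose (obj (copresheaves Q B)) (isbell_up Q A B \<phi>) (isbell_down Q A B \<phi>))
      (\<lambda>y\<in>obj (copresheaves Q B). y)"
    using isbell_counit[OF \<phi>] by (auto simp: qfunctor_le_def compose_def)
  ultimately show ?thesis
    unfolding qadjoint_def using qfunctor_isbell_up[OF \<phi>] qfunctor_isbell_down[OF \<phi>] by blast
qed

end
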